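(* Let $0<p<\infty$ and let $w=(w(n))_{n\in\mathbb{N}}$ be a nonnegative weight sequence. The sequence Lorentz space $\gamma_{p,w}$ is strictly convex if and only if $1<p<\infty$, $w(n)>0$ for every $n\in\mathbb{N}$, and $W(\infty)=\infty$.
   Context: $\mathbb{N}$ is the set of positive integers and $\ell^0$ is the set of all real sequences. For $x\in\ell^0$ put $d_x(\lambda)=\operatorname{card}\{k\in\mathbb{N}:|x(k)|>\lambda\}$ for $\lambda\ge 0$, $x^*(n)=\inf\{\lambda\ge 0: d_x(\lambda)\le n-1\}$ (decreasing rearrangement) and $x^{**}(n)=\frac1n\sum_{i=1}^n x^*(i)$ for $n\in\mathbb{N}$. Weight sequences: for the given $0<p<\infty$, a nonnegative weight sequence is a sequence $w=(w(n))_{n\in\mathbb{N}}$ of nonnegative reals, with $w(n)>0$ for at least one $n$, such that $W_p(n)=n^p\sum_{i=n+1}^\infty \frac{w(i)}{i^p}<\infty$ for every $n\in\mathbb{N}$. Put $W(n)=\sum_{i=1}^n w(i)$ and $W(\infty)=\sum_{i=1}^\infty w(i)\in(0,\infty]$. The sequence Lorentz space $\gamma_{p,w}$ is the space of all $x\in\ell^0$ with $\|x\|_{\gamma_{p,w}}=\left(\sum_{n=1}^\infty (x^{**}(n))^p w(n)\right)^{1/p}<\infty$; it is a quasi-Banach space under this quasi-norm. For a (quasi-)normed space $X$ with unit sphere $S_X$ and closed unit ball $B_X$, a point $x\in S_X$ is an extreme point of $B_X$ if for any $y,z\in S_X$ with $x=(y+z)/2$ one has $x=y=z$. $X$ is strictly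 convex (rotund) if every $x\in S_X$ is an extreme point of $B_X$. *)

theory Defs
  imports "HOL-Analysis.Analysis"
begin

text \<open>
  Sequences indexed by the positive integers are functions on \<^typ>\<open>nat\<close> of which only the values
  at arguments \<open>\<ge> 1\<close> matter. So that distinct elements of a sequence space differ at some
  positive index, the sequences forming the space are normalised to vanish at the index \<open>0\<close>.
\<close>

definition ell0 :: "(nat \<Rightarrow> real) set" where
  "ell0 = {x. x 0 = 0}"

text \<open>
  Cardinalities, rearrangements and the quasi-norm take values in $[0,\infty]$: for an unbounded
  sequence the infimum defining $x^*(n)$ is taken over the empty set and equals $\infty$.
\<close>

definition ennpowr :: "ennreal \<Rightarrow> real \<Rightarrow> ennreal" where
  \<comment> \<open>meant for positive exponents only\<close>
  "ennpowr a r = (if a = \<infinity> then \<infinity> else ennreal (enn2real a powr r))"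

definition distr_fun :: "(nat \<Rightarrow> real) \<Rightarrow> real \<Rightarrow> ennreal" where
  "distr_fun x l = emeasure (count_space {1..}) {k \<in> {1..}. \<bar>x k\<bar> > l}"

definition decr_rearr :: "(nat \<Rightarrow> real) \<Rightarrow> nat \<Rightarrow> ennreal" where
  "decr_rearr x n = (INF l\<in>{l. 0 \<le> l \<and> distr_fun x l \<le> of_nat (n - 1)}. ennreal l)"

definition max_rearr :: "(nat \<Rightarrow> real) \<Rightarrow> nat \<Rightarrow> ennreal" where
  "max_rearr x n = (\<Sum>i=1..n. decr_rearr x i) / of_nat n"

definition W_tail :: "real \<Rightarrow> (nat \<Rightarrow> real) \<Rightarrow> nat \<Rightarrow> ennreal" where
  \<comment> \<open>$W_p(n) = n^p \sum_{i \ge n+1} w(i)/i^p$\<close>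
  "W_tail p w n = ennreal (real n powr p) *
     (\<Sum>j. ennreal (w (n + 1 + j) / real (n + 1 + j) powr p))"

definition W_inf :: "(nat \<Rightarrow> real) \<Rightarrow> ennreal" where
  "W_inf w = (\<Sum>j. ennreal (w (Suc j)))"

definition nonneg_weight :: "real \<Rightarrow> (nat \<Rightarrow> real) \<Rightarrow> bool" where
  "nonneg_weight p w \<longleftrightarrow>
     (\<forall>n\<ge>1. 0 \<le> w n) \<and> (\<exists>n\<ge>1. 0 < w n) \<and> (\<forall>n\<ge>1. W_tail p w n < \<infinity>)"

definition gamma_norm :: "real \<Rightarrow> (nat \<Rightarrow> real) \<Rightarrow> (nat \<Rightarrow> real) \<Rightarrow> ennreal" where
  "gamma_norm p w x =
     ennpowr (\<Sum>j. ennpowr (max_rearr x (Suc j)) p * ennreal (w (Suc j))) (1 / p)"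

definition gamma_space :: "real \<Rightarrow> (nat \<Rightarrow> real) \<Rightarrow> (nat \<Rightarrow> real) set" where
  "gamma_space p w = {x \<in> ell0. gamma_norm p w x < \<infinity>}"

text \<open>
  Here \<open>X\<close> is a linear space of sequences and \<open>N\<close> a quasi-norm that is finite on it.
\<close>

definition unit_sphere :: "(nat \<Rightarrow> real) set \<Rightarrow> ((nat \<Rightarrow> real) \<Rightarrow> ennreal) \<Rightarrow> (nat \<Rightarrow> real) set" where
  "unit_sphere X N = {x \<in> X. N x = 1}"

definition extreme_point_unit_ball ::
    "(nat \<Rightarrow> real) set \<Rightarrow> ((nat \<Rightarrow> real) \<Rightarrow> ennreal) \<Rightarrow> (nat \<Rightarrow> real) \<Rightarrow> bool" where
  "extreme_point_unit_ball X N x \<longleftrightarrow> x \<in> unit_sphere X N \<and>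
     (\<forall>y\<in>unit_sphere X N. \<forall>z\<in>unit_sphere X N.
        x = (\<lambda>k. (y k + z k) / 2) \<longrightarrow> x = y \<and> y = z)"

definition strictly_convex ::
    "(nat \<Rightarrow> real) set \<Rightarrow> ((nat \<Rightarrow> real) \<Rightarrow> ennreal) \<Rightarrow> bool" where
  "strictly_convex X N \<longleftrightarrow> (\<forall>x\<in>unit_sphere X N. extreme_point_unit_ball X N x)"

end

theory Submission
  imports Defs
begin

text \<open>
  Raising the quasi-norm to the power $p$ gives the modular $\sum_n x^{**}(n)^p w(n)$, which is
  homogeneous of degree $p$ and equals $1$ exactly on the unit sphere. So the quasi-norm can be
  forgotten, and strict convexity fails as soon as two different points and their midpoint have
  the same positive finite modular (\<open>not_strictly_convexI\<close>).

  Sufficiency. Let $x = (y + z)/2$ with all three points on the unit sphere. Partial sums of the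
  rearrangement are subadditive, so $x^{**} \le (y^{**} + z^{**})/2$
  (\<open>max_rearr_midpoint_le\<close>). As $t \mapsto t^p$ is strictly convex for $p > 1$ and no weight
  vanishes, equality of the three modulars forces $x^{**} = y^{**} = z^{**}$
  (\<open>max_rearr_eq_of_midpoint\<close>). Since $W(\infty) = \infty$, the level sets of $x$ are finite
  (\<open>finite_level_set\<close>). For a finite set $A$ that carries the largest entries of $x$, the sum of
  $|x|$ over $A$ is the partial sum of $x^*$, which bounds the sums of $|y|$ and of $|z|$ over $A$ as
  well; being at most the average of the latter, it equals both. Comparing two such sets that differ in one
  position $k$ gives $|y(k)| = |x(k)| = |z(k)|$, hence $y(k) = x(k) = z(k)$ (\<open>eq_of_midpoint\<close>).

  Necessity. If $W(\infty) < \infty$, the modular does not see a change of the first entry of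
  $(a, 1, 1, \ldots)$ within $|a| \le 1$. If $w(m) = 0$, it does not see how mass is split between
  the $m$-th and the $(m+1)$-st largest entry: $(2, \ldots, 2, 1, 1, 0, \ldots)$ is the midpoint of
  two rearrangements of $(2, \ldots, 2, 2, 0, \ldots)$. If $p \le 1$ and $w(1) > 0$, consider
  sequences $(a, b, 0, \ldots)$ with $a, b \ge 0$, of modular
  $\max(a, b)^p w(1) + (a + b)^p W_p(1)$. Fix $y = (1, 0, \ldots)$ and let $z$ run on the sphere
  through $y$ from the diagonal to the second axis. The midpoint of $y$ and $z$ starts outside or on
  the sphere, by concavity of $t \mapsto t^p$, and ends inside or on it, so it crosses the sphere
  while $z \ne y$.
\<close>

section \<open>Convexity and concavity of powers\<close>

lemma powr_gt_tangent:
  fixes p t :: real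
  assumes "1 < p" "0 \<le> t" "t \<noteq> 1"
  shows "1 + p * (t - 1) < t powr p"
proof (cases "t = 0")
  case True
  then show ?thesis using assms by simp
next
  case False
  then have "0 < t" using assms by simp
  have der: "((\<lambda>u. u powr p) has_real_derivative p * u powr (p - 1)) (at u)" if "0 < u" for u
    using that by (auto intro!: derivative_eq_intros)
  consider "1 < t" | "t < 1" using assms by linarith
  then show ?thesis
  proof cases
    case 1
    then obtain u where u: "1 < u" "u < t" "t powr p - 1 powr p = (t - 1) * (p * u powr (p - 1))"
      using MVT2[of 1 t "\<lambda>u. u powr p" "\<lambda>u. p * u powr (p - 1)"] der by force
    have "1 < u powr (p - 1)" using powr_less_mono2[of "p - 1" 1 u] u assms by simp
    then have "(t - 1) * (p * 1) < (t - 1) * (p * u powr (p - 1))"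
      using 1 assms by (intro mult_strict_left_mono) auto
    then show ?thesis using u by (simp add: algebra_simps)
  next
    case 2
    then obtain u where u: "t < u" "u < 1" "1 powr p - t powr p = (1 - t) * (p * u powr (p - 1))"
      using MVT2[of t 1 "\<lambda>u. u powr p" "\<lambda>u. p * u powr (p - 1)"] der \<open>0 < t\<close> by force
    have "u powr (p - 1) < 1" 
      using powr_less_mono2[of "p - 1" u 1] u \<open>0 < t\<close> assms by simp
    then have "(1 - t) * (p * u powr (p - 1)) < (1 - t) * (p * 1)"
      using 2 assms by (intro mult_strict_left_mono) auto
    then show ?thesis using u by (simp add: algebra_simps)
  qed
qed

lemma powr_le_tangent:
  fixes p t :: real
  assumes "0 < p" "p \<le> 1" "0 \<le> t"
  shows "t powr p \<le> 1 + p * (t - 1)"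
proof (cases "t = 0")
  case False
  then show ?thesis
    using Youngs_inequality_0[of p "1 - p" t 1] assms by (simp add: algebra_simps)
qed (use assms in simp)

lemma powr_midpoint_less:
  fixes a b p :: real
  assumes "1 < p" "0 \<le> a" "0 \<le> b" "a \<noteq> b"
  shows "((a + b) / 2) powr p < (a powr p + b powr p) / 2"
proof -
  define m where "m = (a + b) / 2"
  have m: "0 < m" using assms by (auto simp: m_def)
  have a: "a = m * (a / m)" and b: "b = m * (b / m)" using m by auto
  have "1 + p * (a / m - 1) < (a / m) powr p" "1 + p * (b / m - 1) < (b / m) powr p"
    using assms m by (auto intro!: powr_gt_tangent) (auto simp: m_def field_simps)
  moreover have "a + b = 2 * m" by (simp add: m_def)
  then have "a / m + b / m = 2" using m by (simp flip: add_divide_distrib)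
  then have "p * (a / m - 1) + p * (b / m - 1) = 0"
    by (simp flip: distrib_left)
  ultimately have "2 < (a / m) powr p + (b / m) powr p" by linarith
  then have "m powr p * 2 < m powr p * ((a / m) powr p + (b / m) powr p)"
    using m by (intro mult_strict_left_mono) auto
  also have "\<dots> = a powr p + b powr p"
    using m assms by (simp add: distrib_left flip: powr_mult)
  finally show ?thesis by (simp add: m_def)
qed

lemma powr_midpoint_ge:
  fixes a b p :: real
  assumes "0 < p" "p \<le> 1" "0 \<le> a" "0 \<le> b"
  shows "(a powr p + b powr p) / 2 \<le> ((a + b) / 2) powr p"
proof (cases "a + b = 0")
  case True
  then have "a = 0" "b = 0" using assms by auto
  then show ?thesis by simp
next
  case False
  define m where "m = (a + b) / 2"
  have m: "0 < m" using assms False by (auto simp: m_def)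
  have "(a / m) powr p \<le> 1 + p * (a / m - 1)" "(b / m) powr p \<le> 1 + p * (b / m - 1)"
    using assms m by (auto intro!: powr_le_tangent)
  moreover have "a + b = 2 * m" by (simp add: m_def)
  then have "a / m + b / m = 2" using m by (simp flip: add_divide_distrib)
  then have "p * (a / m - 1) + p * (b / m - 1) = 0"
    by (simp flip: distrib_left)
  ultimately have "(a / m) powr p + (b / m) powr p \<le> 2" by linarith
  then have "m powr p * ((a / m) powr p + (b / m) powr p) \<le> m powr p * 2"
    using m by (intro mult_left_mono) auto
  also have "m powr p * ((a / m) powr p + (b / m) powr p) = a powr p + b powr p"
    using m assms by (simp add: distrib_left flip: powr_mult)
  finally show ?thesis by (simp add: m_def)
qed

section \<open>The decreasing rearrangement\<close>

lemma distr_fun_le_iff: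
  "distr_fun x l \<le> of_nat m \<longleftrightarrow> finite {k \<in> {1..}. l < \<bar>x k\<bar>} \<and> card {k \<in> {1..}. l < \<bar>x k\<bar>} \<le> m"
  unfolding distr_fun_def by (subst emeasure_count_space) (auto simp: top_unique)

lemma decr_rearr_le:
  assumes "0 \<le> l" "finite {k \<in> {1..}. l < \<bar>x k\<bar>}" "card {k \<in> {1..}. l < \<bar>x k\<bar>} \<le> n - 1"
  shows "decr_rearr x n \<le> ennreal l"
  unfolding decr_rearr_def using assms by (auto intro!: INF_lower simp: distr_fun_le_iff)

lemma decr_rearr_ge:
  assumes "\<And>l. 0 \<le> l \<Longrightarrow> finite {k \<in> {1..}. l < \<bar>x k\<bar>} \<Longrightarrow>
             card {k \<in> {1..}. l < \<bar>x k\<bar>} \<le> n - 1 \<Longrightarrow> c \<le> ennreal l"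
  shows "c \<le> decr_rearr x n"
  unfolding decr_rearr_def using assms by (intro INF_greatest) (auto simp: distr_fun_le_iff)

lemma decr_rearr_ge_card:
  assumes "A \<subseteq> {1..}" "finite A" "n \<le> card A" "0 < n" "\<And>k. k \<in> A \<Longrightarrow> c \<le> \<bar>x k\<bar>"
  shows "ennreal c \<le> decr_rearr x n"
proof (rule decr_rearr_ge, rule ccontr)
  fix l :: real
  assume l: "0 \<le> l" and fin: "finite {k \<in> {1..}. l < \<bar>x k\<bar>}"
    and card: "card {k \<in> {1..}. l < \<bar>x k\<bar>} \<le> n - 1" and "\<not> ennreal c \<le> ennreal l"
  then have "l < c" by (simp add: ennreal_le_iff2 not_le)
  then have "A \<subseteq> {k \<in> {1..}. l < \<bar>x k\<bar>}" using assms by force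
  from card_mono[OF fin this] card assms show False by simp
qed

lemma decr_rearr_antimono: "m \<le> n \<Longrightarrow> decr_rearr x n \<le> decr_rearr x m"
  unfolding decr_rearr_def by (intro INF_superset_mono) (auto simp: distr_fun_le_iff)

text \<open>
  Rescaling by \<open>c\<close> turns an admissible level \<open>l\<close> into the admissible level \<open>c * l\<close>; one inequality
  applied to both \<open>c\<close> and \<open>1 / c\<close> gives equality.
\<close>

lemma decr_rearr_scale:
  assumes "0 < c"
  shows "decr_rearr (\<lambda>k. c * x k) n = ennreal c * decr_rearr x n"
proof -
  have le: "ennreal (1 / c) * decr_rearr (\<lambda>k. c * x k) n \<le> decr_rearr x n" if c: "0 < c" for c x
  proof (rule decr_rearr_ge)
    fix l :: real
    assume l: "0 \<le> l" "finite {k \<in> {1..}. l < \<bar>x k\<bar>}" "card {k \<in> {1..}. l < \<bar>x k\<bar>} \<le> n - 1"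
    have "{k \<in> {1..}. c * l < \<bar>c * x k\<bar>} = {k \<in> {1..}. l < \<bar>x k\<bar>}"
      using c by (auto simp: abs_mult)
    with l c have "decr_rearr (\<lambda>k. c * x k) n \<le> ennreal (c * l)"
      by (intro decr_rearr_le) auto
    then have "ennreal (1 / c) * decr_rearr (\<lambda>k. c * x k) n \<le> ennreal (1 / c) * ennreal (c * l)"
      by (rule mult_left_mono) simp
    also have "\<dots> = ennreal l" using c l by (simp flip: ennreal_mult)
    finally show "ennreal (1 / c) * decr_rearr (\<lambda>k. c * x k) n \<le> ennreal l" .
  qed
  have "decr_rearr (\<lambda>k. c * x k) n = ennreal c * (ennreal (1 / c) * decr_rearr (\<lambda>k. c * x k) n)"
    using assms by (simp flip: ennreal_mult mult.assoc)
  also have "\<dots> \<le> ennreal c * decr_rearr x n"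
    using le[OF assms] by (rule mult_left_mono) simp
  finally show ?thesis
    using le[of "1 / c" "\<lambda>k. c * x k"] assms by (intro antisym) simp_all
qed

lemma decr_rearr_decreasing:
  assumes "\<And>k. 1 \<le> k \<Longrightarrow> 0 \<le> x k" "\<And>j k. 1 \<le> j \<Longrightarrow> j \<le> k \<Longrightarrow> x k \<le> x j" "1 \<le> n"
  shows "decr_rearr x n = ennreal (x n)"
proof (rule antisym)
  have sub: "{k \<in> {1..}. x n < \<bar>x k\<bar>} \<subseteq> {1..<n}"
  proof
    fix k assume "k \<in> {k \<in> {1..}. x n < \<bar>x k\<bar>}"
    then have "1 \<le> k" "x n < x k" using assms(1)[of k] by auto
    then show "k \<in> {1..<n}" using assms(2)[of n k] \<open>1 \<le> n\<close> by force
  qed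
  show "decr_rearr x n \<le> ennreal (x n)"
    using assms finite_subset[OF sub] card_mono[OF _ sub] by (intro decr_rearr_le) auto
  show "ennreal (x n) \<le> decr_rearr x n"
  proof (rule decr_rearr_ge_card)
    fix k assume "k \<in> {1..n}"
    then show "x n \<le> \<bar>x k\<bar>" using assms(2)[of k n] by fastforce
  qed (use assms in auto)
qed

lemma decr_rearr_cong_distr:
  "(\<And>l. 0 \<le> l \<Longrightarrow> distr_fun x l = distr_fun y l) \<Longrightarrow> decr_rearr x n = decr_rearr y n"
  unfolding decr_rearr_def by (intro INF_cong) auto

lemma decr_rearr_swap:
  assumes "1 \<le> i" "1 \<le> j"
  shows "decr_rearr (x \<circ> Transposition.transpose i j) n = decr_rearr x n"
proof (rule decr_rearr_cong_distr)
  fix l :: real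
  let ?t = "Transposition.transpose i j" and ?A = "{k \<in> {1..}. l < \<bar>x k\<bar>}"
  have *: "{k \<in> {1..}. l < \<bar>(x \<circ> ?t) k\<bar>} = ?t ` ?A"
  proof -
    have pos: "?t k \<in> {1..} \<longleftrightarrow> k \<in> {1..}" for k
      using assms by (auto simp: Transposition.transpose_def)
    show ?thesis
    proof (rule set_eqI)
      fix k
      have "k \<in> ?t ` ?A \<longleftrightarrow> ?t k \<in> ?A"
      proof
        assume "?t k \<in> ?A"
        then have "?t (?t k) \<in> ?t ` ?A" by (rule imageI)
        then show "k \<in> ?t ` ?A" by (simp only: transpose_involutory)
      qed (auto simp only: transpose_involutory)
      then show "k \<in> {k \<in> {1..}. l < \<bar>(x \<circ> ?t) k\<bar>} \<longleftrightarrow> k \<in> ?t ` ?A"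
        using pos[of k] by simp
    qed
  qed
  have "inj_on ?t ?A" by (meson inj_on_subset inj_transpose subset_UNIV)
  then have eq: "finite (?t ` ?A) = finite ?A" "card (?t ` ?A) = card ?A"
    by (simp_all add: card_image finite_image_iff)
  have "?t ` ?A \<subseteq> {1..}" unfolding *[symmetric] by auto
  then have "distr_fun (x \<circ> ?t) l = (if finite (?t ` ?A) then of_nat (card (?t ` ?A)) else \<infinity>)"
    unfolding distr_fun_def * by (rule emeasure_count_space)
  also have "\<dots> = distr_fun x l"
    unfolding distr_fun_def eq by (rule emeasure_count_space[symmetric]) auto
  finally show "distr_fun (x \<circ> ?t) l = distr_fun x l" .
qed

section \<open>Partial sums of the rearrangement\<close>

text \<open>
  Induction on the cardinality, removing a smallest entry: all of \<open>A\<close> lies at or above that entry,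
  so the rearrangement is at least as large at the index \<open>card A\<close>.
\<close>

lemma sum_abs_le_sum_decr_rearr:
  assumes "finite A" "A \<subseteq> {1..}"
  shows "ennreal (\<Sum>k\<in>A. \<bar>x k\<bar>) \<le> (\<Sum>i=1..card A. decr_rearr x i)"
  using assms
proof (induction "card A" arbitrary: A)
  case 0
  then show ?case by simp
next
  case (Suc n)
  define k where "k = arg_min_on (\<lambda>k. \<bar>x k\<bar>) A"
  have "A \<noteq> {}" using Suc by auto
  then have k: "k \<in> A" "\<And>j. j \<in> A \<Longrightarrow> \<bar>x k\<bar> \<le> \<bar>x j\<bar>"
    unfolding k_def using Suc by (auto intro: arg_min_if_finite arg_min_least)
  have card: "n = card (A - {k})" using k Suc by simp
  have "ennreal (\<Sum>k\<in>A. \<bar>x k\<bar>) = ennreal (\<Sum>k\<in>A - {k}. \<bar>x k\<bar>) + ennreal \<bar>x k\<bar>"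
    using k Suc by (simp add: sum.remove[of A k] sum_nonneg add.commute flip: ennreal_plus)
  also have "\<dots> \<le> (\<Sum>i=1..n. decr_rearr x i) + decr_rearr x (Suc n)"
  proof (rule add_mono)
    have "finite (A - {k})" "A - {k} \<subseteq> {1..}" using Suc.prems by auto
    then show "ennreal (\<Sum>k\<in>A - {k}. \<bar>x k\<bar>) \<le> (\<Sum>i=1..n. decr_rearr x i)"
      using Suc.hyps(1)[OF card] by (simp only: flip: card)
    show "ennreal \<bar>x k\<bar> \<le> decr_rearr x (Suc n)"
      by (rule decr_rearr_ge_card[OF Suc.prems(2,1)]) (use Suc.hyps(2) k(2) in simp_all)
  qed
  finally show ?case unfolding Suc.hyps(2)[symmetric] by simp
qed

text \<open>
  A set of positions which carries the largest entries realises the partial sum: its smallest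
  entry dominates everything but the others, so it bounds the last summand from above, and
  removing it leaves a set of the same kind.
\<close>

lemma sum_decr_rearr_top_set:
  assumes "finite A" "A \<subseteq> {1..}"
    and "\<And>i j. i \<in> A \<Longrightarrow> 1 \<le> j \<Longrightarrow> j \<notin> A \<Longrightarrow> \<bar>x j\<bar> \<le> \<bar>x i\<bar>"
  shows "(\<Sum>i=1..card A. decr_rearr x i) = ennreal (\<Sum>k\<in>A. \<bar>x k\<bar>)"
proof (intro antisym sum_abs_le_sum_decr_rearr assms)
  show "(\<Sum>i=1..card A. decr_rearr x i) \<le> ennreal (\<Sum>k\<in>A. \<bar>x k\<bar>)"
    using assms
  proof (induction "card A" arbitrary: A)
    case 0
    then show ?case by simp
  next
    case (Suc n)
    define k where "k = arg_min_on (\<lambda>k. \<bar>x k\<bar>) A"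
    have "A \<noteq> {}" using Suc by auto
    then have k: "k \<in> A" "\<And>j. j \<in> A \<Longrightarrow> \<bar>x k\<bar> \<le> \<bar>x j\<bar>"
      unfolding k_def using Suc by (auto intro: arg_min_if_finite arg_min_least)
    have card: "n = card (A - {k})" using k Suc by simp
    have sub: "{j \<in> {1..}. \<bar>x k\<bar> < \<bar>x j\<bar>} \<subseteq> A - {k}"
      using Suc.prems(3)[OF k(1)] by force
    have fin: "finite (A - {k})" using Suc by simp
    have top: "\<bar>x j\<bar> \<le> \<bar>x i\<bar>" if "i \<in> A - {k}" "1 \<le> j" "j \<notin> A - {k}" for i j
      using that Suc.prems(3)[of i j] k(2) by blast
    have "A - {k} \<subseteq> {1..}" using Suc.prems by blast
    then have "(\<Sum>i=1..card (A - {k}). decr_rearr x i) \<le> ennreal (\<Sum>k\<in>A - {k}. \<bar>x k\<bar>)"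
      by (rule Suc.hyps(1)[OF card fin]) (rule top)
    then have "(\<Sum>i=1..n. decr_rearr x i) \<le> ennreal (\<Sum>k\<in>A - {k}. \<bar>x k\<bar>)"
      by (simp only: card)
    moreover have "decr_rearr x (Suc n) \<le> ennreal \<bar>x k\<bar>"
      using finite_subset[OF sub fin] card_mono[OF fin sub] card by (intro decr_rearr_le) auto
    ultimately have "(\<Sum>i=1..Suc n. decr_rearr x i) \<le> ennreal (\<Sum>k\<in>A - {k}. \<bar>x k\<bar>) + ennreal \<bar>x k\<bar>"
      by (simp add: add_mono)
    also have "\<dots> = ennreal (\<Sum>k\<in>A. \<bar>x k\<bar>)"
      using k Suc by (simp add: sum.remove[of A k] sum_nonneg add.commute flip: ennreal_plus)
    finally show ?case unfolding Suc.hyps(2)[symmetric] by simp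
  qed
qed

text \<open>
  The supremum of the sums over \<open>n\<close> positions need not be attained, so each position is chosen
  greedily up to an error \<open>e\<close>. If no position outside \<open>A\<close> reached \<open>decr_rearr x (Suc n) - e\<close>, that level would be
  exceeded on \<open>A\<close> only, hence at most \<open>n\<close> times, and would bound the rearrangement.
\<close>

lemma exists_set_almost_realising:
  assumes fin: "\<And>i. 1 \<le> i \<Longrightarrow> decr_rearr x i < \<infinity>" and e: "0 < e"
  shows "\<exists>A. finite A \<and> A \<subseteq> {1..} \<and> card A = n \<and>
           (\<Sum>i=1..n. decr_rearr x i) \<le> ennreal ((\<Sum>k\<in>A. \<bar>x k\<bar>) + real n * e)"
proof (induction n)
  case 0
  then show ?case by (intro exI[of _ "{}"]) simp
next
  case (Suc n)
  then obtain A where A: "finite A" "A \<subseteq> {1..}" "card A = n"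
    "(\<Sum>i=1..n. decr_rearr x i) \<le> ennreal ((\<Sum>k\<in>A. \<bar>x k\<bar>) + real n * e)" by blast
  obtain t where t: "0 \<le> t" "decr_rearr x (Suc n) = ennreal t"
    using fin[of "Suc n"] by (cases "decr_rearr x (Suc n)") auto
  have "\<exists>k\<in>{1..} - A. t - e \<le> \<bar>x k\<bar>"
  proof (rule ccontr)
    assume "\<not> ?thesis"
    then have *: "\<bar>x k\<bar> < t - e" if "1 \<le> k" "k \<notin> A" for k
      using that by force
    obtain m where "m \<in> {1..} - A" using A(1) infinite_Ici[of "1::nat"]
      by (metis Diff_eq_empty_iff ex_in_conv finite_subset)
    then have pos: "0 \<le> t - e" using *[of m] by force
    have sub: "{k \<in> {1..}. t - e < \<bar>x k\<bar>} \<subseteq> A" using * by force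
    have "decr_rearr x (Suc n) \<le> ennreal (t - e)"
      using pos finite_subset[OF sub A(1)] card_mono[OF A(1) sub] A(3)
      by (intro decr_rearr_le) auto
    with t e pos show False by simp
  qed
  then obtain k where k: "1 \<le> k" "k \<notin> A" "t - e \<le> \<bar>x k\<bar>" by auto
  have "(\<Sum>i=1..Suc n. decr_rearr x i) \<le> ennreal ((\<Sum>k\<in>A. \<bar>x k\<bar>) + real n * e) + ennreal t"
    using A t by (simp add: add_mono)
  also have "\<dots> = ennreal ((\<Sum>k\<in>A. \<bar>x k\<bar>) + real n * e + t)"
    using t e by (simp add: sum_nonneg flip: ennreal_plus)
  also have "\<dots> \<le> ennreal ((\<Sum>k\<in>insert k A. \<bar>x k\<bar>) + real (Suc n) * e)"
    using A k by (intro ennreal_leI) (simp add: algebra_simps)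
  finally show ?case using A k by (intro exI[of _ "insert k A"]) auto
qed

lemma sum_decr_rearr_midpoint_le:
  assumes x: "\<And>k. 1 \<le> k \<Longrightarrow> x k = (y k + z k) / 2"
    and fin: "\<And>i. 1 \<le> i \<Longrightarrow> decr_rearr x i < \<infinity>"
  shows "2 * (\<Sum>i=1..n. decr_rearr x i) \<le> (\<Sum>i=1..n. decr_rearr y i) + (\<Sum>i=1..n. decr_rearr z i)"
    (is "2 * ?X \<le> ?Y + ?Z")
proof (rule ennreal_le_epsilon)
  fix e :: real assume "0 < e"
  \<comment> \<open>Each of the \<open>n\<close> choices costs \<open>d\<close>, and the factor \<open>2\<close> of the claim doubles it; \<open>Suc\<close> covers \<open>n = 0\<close>.\<close>
  define d where "d = e / (2 * real (Suc n))"
  have d: "0 < d" "2 * (real n * d) \<le> e" using \<open>0 < e\<close> by (auto simp: d_def field_simps)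
  obtain A where A: "finite A" "A \<subseteq> {1..}" "card A = n" "?X \<le> ennreal ((\<Sum>k\<in>A. \<bar>x k\<bar>) + real n * d)"
    using exists_set_almost_realising[of x d n] fin d by blast
  have "(\<Sum>k\<in>A. 2 * \<bar>x k\<bar>) \<le> (\<Sum>k\<in>A. \<bar>y k\<bar> + \<bar>z k\<bar>)"
  proof (rule sum_mono)
    fix k assume "k \<in> A"
    then show "2 * \<bar>x k\<bar> \<le> \<bar>y k\<bar> + \<bar>z k\<bar>" using A x[of k] by fastforce
  qed
  then have le: "2 * (\<Sum>k\<in>A. \<bar>x k\<bar>) \<le> (\<Sum>k\<in>A. \<bar>y k\<bar>) + (\<Sum>k\<in>A. \<bar>z k\<bar>)"
    by (simp add: sum.distrib sum_distrib_left)
  have "2 * ?X \<le> 2 * ennreal ((\<Sum>k\<in>A. \<bar>x k\<bar>) + real n * d)"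
    using A by (intro mult_left_mono) auto
  also have "\<dots> = ennreal (2 * ((\<Sum>k\<in>A. \<bar>x k\<bar>) + real n * d))"
    using d by (intro numeral_mult_ennreal) (simp add: sum_nonneg)
  also have "\<dots> \<le> ennreal ((\<Sum>k\<in>A. \<bar>y k\<bar>) + (\<Sum>k\<in>A. \<bar>z k\<bar>) + e)"
    using le d by (intro ennreal_leI) simp
  also have "\<dots> = ennreal (\<Sum>k\<in>A. \<bar>y k\<bar>) + ennreal (\<Sum>k\<in>A. \<bar>z k\<bar>) + ennreal e"
    using \<open>0 < e\<close> by (simp add: sum_nonneg ennreal_plus)
  also have "\<dots> \<le> ?Y + ?Z + ennreal e"
    using sum_abs_le_sum_decr_rearr[of A] A by (intro add_mono) auto
  finally show "2 * ?X \<le> ?Y + ?Z + ennreal e" .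
qed

section \<open>Rigidity of midpoints with equal rearrangements\<close>

text \<open>
  The sum of $|x|$ over \<open>A\<close> is at most the average of those of $|y|$ and $|z|$, while each of these is
  at most the common partial sum, which is the sum of $|x|$ over \<open>A\<close>.
\<close>

lemma abs_eq_of_midpoint_top_set:
  assumes x: "\<And>k. 1 \<le> k \<Longrightarrow> x k = (y k + z k) / 2"
    and y: "\<And>n. (\<Sum>i=1..n. decr_rearr y i) = (\<Sum>i=1..n. decr_rearr x i)"
    and z: "\<And>n. (\<Sum>i=1..n. decr_rearr z i) = (\<Sum>i=1..n. decr_rearr x i)"
    and A: "finite A" "A \<subseteq> {1..}"
    and top: "\<And>i j. i \<in> A \<Longrightarrow> 1 \<le> j \<Longrightarrow> j \<notin> A \<Longrightarrow> \<bar>x j\<bar> \<le> \<bar>x i\<bar>"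
  shows "(\<Sum>k\<in>A. \<bar>y k\<bar>) = (\<Sum>k\<in>A. \<bar>x k\<bar>)"
proof -
  have S: "(\<Sum>i=1..card A. decr_rearr x i) = ennreal (\<Sum>k\<in>A. \<bar>x k\<bar>)"
    using A top by (rule sum_decr_rearr_top_set)
  have "(\<Sum>k\<in>A. 2 * \<bar>x k\<bar>) \<le> (\<Sum>k\<in>A. \<bar>y k\<bar> + \<bar>z k\<bar>)"
  proof (rule sum_mono)
    fix k assume "k \<in> A"
    then show "2 * \<bar>x k\<bar> \<le> \<bar>y k\<bar> + \<bar>z k\<bar>" using A x[of k] by fastforce
  qed
  then have "2 * (\<Sum>k\<in>A. \<bar>x k\<bar>) \<le> (\<Sum>k\<in>A. \<bar>y k\<bar>) + (\<Sum>k\<in>A. \<bar>z k\<bar>)"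
    by (simp add: sum.distrib sum_distrib_left)
  moreover have "(\<Sum>k\<in>A. \<bar>y k\<bar>) \<le> (\<Sum>k\<in>A. \<bar>x k\<bar>)"
    using sum_abs_le_sum_decr_rearr[OF A, of y] unfolding y S by (simp add: sum_nonneg)
  moreover have "(\<Sum>k\<in>A. \<bar>z k\<bar>) \<le> (\<Sum>k\<in>A. \<bar>x k\<bar>)"
    using sum_abs_le_sum_decr_rearr[OF A, of z] unfolding z S by (simp add: sum_nonneg)
  ultimately show ?thesis by linarith
qed

text \<open>
  At a nonzero entry, the positions with entries at least as large carry the largest entries, and
  still do so when the given position is removed. At a zero entry, no position can be removed, and
  the entry of \<open>y\<close> is instead added to a level set of \<open>x\<close>: it fits below the next rearranged value,
  which is arbitrarily small.
\<close>

lemma abs_eq_of_midpoint: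
  assumes x: "\<And>k. 1 \<le> k \<Longrightarrow> x k = (y k + z k) / 2"
    and y: "\<And>n. (\<Sum>i=1..n. decr_rearr y i) = (\<Sum>i=1..n. decr_rearr x i)"
    and z: "\<And>n. (\<Sum>i=1..n. decr_rearr z i) = (\<Sum>i=1..n. decr_rearr x i)"
    and fin: "\<And>e. 0 < e \<Longrightarrow> finite {k \<in> {1..}. e < \<bar>x k\<bar>}"
    and k: "1 \<le> k"
  shows "\<bar>y k\<bar> = \<bar>x k\<bar>"
proof -
  have eq: "(\<Sum>k\<in>A. \<bar>y k\<bar>) = (\<Sum>k\<in>A. \<bar>x k\<bar>)"
    if "finite A" "A \<subseteq> {1..}" "\<And>i j. i \<in> A \<Longrightarrow> 1 \<le> j \<Longrightarrow> j \<notin> A \<Longrightarrow> \<bar>x j\<bar> \<le> \<bar>x i\<bar>" for A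
    by (rule abs_eq_of_midpoint_top_set[of x y z A]) (fact x y z that)+
  show ?thesis
  proof (cases "x k = 0")
    case False
    define B where "B = {j \<in> {1..}. \<bar>x k\<bar> \<le> \<bar>x j\<bar>}"
    have "B \<subseteq> {j \<in> {1..}. \<bar>x k\<bar> / 2 < \<bar>x j\<bar>}"
      using False by (auto simp: B_def)
    moreover have "finite {j \<in> {1..}. \<bar>x k\<bar> / 2 < \<bar>x j\<bar>}"
      using False by (intro fin) simp
    ultimately have B: "finite B" by (rule finite_subset)
    have B1: "B \<subseteq> {1..}" unfolding B_def by blast
    have top: "\<bar>x j\<bar> \<le> \<bar>x k\<bar>" "\<bar>x k\<bar> \<le> \<bar>x i\<bar>" if "i \<in> B" "1 \<le> j" "j \<notin> B - {k}" for i j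
      using that unfolding B_def by fastforce+
    have "k \<in> B" using k by (simp add: B_def)
    have "(\<Sum>j\<in>B. \<bar>y j\<bar>) = (\<Sum>j\<in>B. \<bar>x j\<bar>)"
      using B B1 by (rule eq) (meson DiffD1 order_trans top)
    moreover have "(\<Sum>j\<in>B - {k}. \<bar>y j\<bar>) = (\<Sum>j\<in>B - {k}. \<bar>x j\<bar>)"
    proof (rule eq)
      show "finite (B - {k})" "B - {k} \<subseteq> {1..}" using B B1 by blast+
    qed (meson DiffD1 order_trans top)
    ultimately show ?thesis
      using B \<open>k \<in> B\<close> by (simp add: sum.remove[of B k])
  next
    case True
    have "\<bar>y k\<bar> \<le> e" if "0 < e" for e
    proof -
      define A where "A = {j \<in> {1..}. e < \<bar>x j\<bar>}"
      have A: "A \<subseteq> {1..}" "finite A" "k \<notin> A"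
        using fin[OF that] that True by (auto simp: A_def)
      have top: "\<bar>x j\<bar> \<le> \<bar>x i\<bar>" if "i \<in> A" "1 \<le> j" "j \<notin> A" for i j
        using that by (auto simp: A_def)
      have yA: "(\<Sum>j\<in>A. \<bar>y j\<bar>) = (\<Sum>j\<in>A. \<bar>x j\<bar>)"
        using A(2,1) top by (rule eq)
      have "ennreal (\<bar>y k\<bar> + (\<Sum>j\<in>A. \<bar>y j\<bar>)) \<le> (\<Sum>i=1..Suc (card A). decr_rearr y i)"
        using sum_abs_le_sum_decr_rearr[of "insert k A" y] A k by simp
      also have "\<dots> = (\<Sum>i=1..card A. decr_rearr x i) + decr_rearr x (Suc (card A))"
        unfolding y by simp
      also have "\<dots> \<le> ennreal (\<Sum>j\<in>A. \<bar>x j\<bar>) + ennreal e"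
      proof (intro add_mono)
        show "(\<Sum>i=1..card A. decr_rearr x i) \<le> ennreal (\<Sum>j\<in>A. \<bar>x j\<bar>)"
          by (rule eq_refl, rule sum_decr_rearr_top_set[OF A(2,1)]) (rule top)
        show "decr_rearr x (Suc (card A)) \<le> ennreal e"
          using A that by (intro decr_rearr_le) (auto simp: A_def)
      qed
      also have "\<dots> = ennreal (e + (\<Sum>j\<in>A. \<bar>y j\<bar>))"
        using that by (simp add: yA sum_nonneg add.commute)
      finally show ?thesis using that by (simp add: sum_nonneg ennreal_le_iff)
    qed
    then have "\<bar>y k\<bar> \<le> 0" by - (rule field_le_epsilon, simp)
    then show ?thesis using True by simp
  qed
qed

lemma eq_of_midpoint:
  assumes x: "\<And>k. 1 \<le> k \<Longrightarrow> x k = (y k + z k) / 2"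
    and y: "\<And>n. (\<Sum>i=1..n. decr_rearr y i) = (\<Sum>i=1..n. decr_rearr x i)"
    and z: "\<And>n. (\<Sum>i=1..n. decr_rearr z i) = (\<Sum>i=1..n. decr_rearr x i)"
    and fin: "\<And>e. 0 < e \<Longrightarrow> finite {k \<in> {1..}. e < \<bar>x k\<bar>}"
    and k: "1 \<le> k"
  shows "y k = x k" "z k = x k"
proof -
  have "x k = (z k + y k) / 2" if "1 \<le> k" for k using x[OF that] by simp
  then have "\<bar>y k\<bar> = \<bar>x k\<bar>" "\<bar>z k\<bar> = \<bar>x k\<bar>"
    using abs_eq_of_midpoint[OF x y z fin k] abs_eq_of_midpoint[OF _ z y fin k] by auto
  then show "y k = x k" "z k = x k" using x[OF k] by (auto simp: abs_if split: if_splits)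
qed

section \<open>The modular and the unit sphere\<close>

definition gamma_modular :: "real \<Rightarrow> (nat \<Rightarrow> real) \<Rightarrow> (nat \<Rightarrow> real) \<Rightarrow> ennreal" where
  "gamma_modular p w x = (\<Sum>j. ennpowr (max_rearr x (Suc j)) p * ennreal (w (Suc j)))"

lemma ennpowr_ennreal: "0 \<le> a \<Longrightarrow> ennpowr (ennreal a) r = ennreal (a powr r)"
  by (simp add: ennpowr_def)

lemma ennpowr_eq_1_iff: "0 < r \<Longrightarrow> ennpowr a r = 1 \<longleftrightarrow> a = 1"
  by (cases a) (auto simp: ennpowr_def powr_def split: if_splits)

lemma ennpowr_mono: "0 < r \<Longrightarrow> a \<le> b \<Longrightarrow> ennpowr a r \<le> ennpowr b r"
  by (cases a; cases b) (auto simp: ennpowr_def top_unique intro!: ennreal_leI powr_mono2)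

lemma ennpowr_scale:
  "0 < c \<Longrightarrow> ennpowr (ennreal c * a) r = ennreal (c powr r) * ennpowr a r"
  by (cases a) (auto simp: ennpowr_def ennreal_mult_top powr_mult simp flip: ennreal_mult)

lemma in_unit_sphere_gamma_iff:
  assumes "0 < p"
  shows "x \<in> unit_sphere (gamma_space p w) (gamma_norm p w) \<longleftrightarrow> x 0 = 0 \<and> gamma_modular p w x = 1"
  using ennpowr_eq_1_iff[of "1 / p" "gamma_modular p w x"] assms
  by (auto simp: unit_sphere_def gamma_space_def ell0_def gamma_norm_def gamma_modular_def)

lemma gamma_modular_scale:
  assumes "0 < c"
  shows "gamma_modular p w (\<lambda>k. c * x k) = ennreal (c powr p) * gamma_modular p w x"
proof -
  have "max_rearr (\<lambda>k. c * x k) n = ennreal c * max_rearr x n" for n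
    using assms unfolding max_rearr_def
    by (simp add: decr_rearr_scale sum_distrib_left ennreal_times_divide)
  then show ?thesis
    using assms by (simp add: gamma_modular_def ennpowr_scale mult.assoc)
qed

text \<open>
  By homogeneity, an extreme point is missing as soon as some point is the midpoint of two
  others on one sphere about the origin, whatever the radius.
\<close>

lemma not_strictly_convexI:
  assumes "0 < p" and M: "0 < M" "M < \<infinity>"
    and "gamma_modular p w x = M" "gamma_modular p w y = M" "gamma_modular p w z = M"
    and "x 0 = 0" "y 0 = 0" "z 0 = 0" and mid: "\<And>k. x k = (y k + z k) / 2" and "y \<noteq> z"
  shows "\<not> strictly_convex (gamma_space p w) (gamma_norm p w)"
proof
  assume sc: "strictly_convex (gamma_space p w) (gamma_norm p w)"
  obtain m where m: "M = ennreal m" "0 < m" using M by (cases M) auto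
  define c where "c = (1 / m) powr (1 / p)"
  have c: "0 < c" "c powr p = 1 / m" using m assms by (auto simp: c_def powr_powr)
  define S where "S = unit_sphere (gamma_space p w) (gamma_norm p w)"
  have *: "(\<lambda>k. c * v k) \<in> S" if "gamma_modular p w v = M" "v 0 = 0" for v
    using that m c unfolding S_def in_unit_sphere_gamma_iff[OF \<open>0 < p\<close>]
    by (simp add: gamma_modular_scale flip: ennreal_mult)
  have S: "(\<lambda>k. c * x k) \<in> S" "(\<lambda>k. c * y k) \<in> S" "(\<lambda>k. c * z k) \<in> S"
    by (rule *; fact)+
  have "(\<lambda>k. c * x k) = (\<lambda>k. (c * y k + c * z k) / 2)"
  proof
    fix k show "c * x k = (c * y k + c * z k) / 2" unfolding mid[of k] by (simp add: distrib_left)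
  qed
  moreover have "extreme_point_unit_ball (gamma_space p w) (gamma_norm p w) (\<lambda>k. c * x k)"
    using sc S(1) unfolding strictly_convex_def S_def by (rule bspec)
  ultimately have "(\<lambda>k. c * y k) = (\<lambda>k. c * z k)"
    using S unfolding extreme_point_unit_ball_def S_def by simp
  then have "c * y k = c * z k" for k by (rule fun_cong)
  then have "y k = z k" for k using c by simp
  then have "y = z" by (rule ext)
  with \<open>y \<noteq> z\<close> show False ..
qed

lemma max_rearr_eq_top_iff:
  assumes "1 \<le> n"
  shows "max_rearr x n = \<infinity> \<longleftrightarrow> decr_rearr x 1 = \<infinity>"
proof
  assume "max_rearr x n = \<infinity>"
  then have "(\<Sum>i=1..n. decr_rearr x i) = \<infinity>"
    using assms by (auto simp: max_rearr_def ennreal_divide_eq_top_iff)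
  then obtain i where i: "1 \<le> i" "decr_rearr x i = \<infinity>" by auto
  with decr_rearr_antimono[of 1 i x] show "decr_rearr x 1 = \<infinity>" by (simp add: top_unique)
next
  assume "decr_rearr x 1 = \<infinity>"
  moreover have "1 \<in> {1..n}" using assms by simp
  ultimately have "(\<Sum>i=1..n. decr_rearr x i) = \<infinity>" by auto
  then show "max_rearr x n = \<infinity>"
    unfolding max_rearr_def by (simp only:) (simp add: ennreal_top_divide)
qed

lemma suminf_ennreal_term_le: "f i \<le> (\<Sum>j. f j :: ennreal)"
  using sum_le_suminf[of f "{i}"] by simp

lemma decr_rearr_finite:
  assumes "gamma_modular p w x < \<infinity>" "1 \<le> n" "0 < w n" "1 \<le> i"
  shows "decr_rearr x i < \<infinity>"
proof -
  have "ennpowr (max_rearr x n) p * ennreal (w n) \<le> gamma_modular p w x"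
    unfolding gamma_modular_def
    using suminf_ennreal_term_le[of "\<lambda>j. ennpowr (max_rearr x (Suc j)) p * ennreal (w (Suc j))" "n - 1"]
      assms by simp
  with assms have "ennpowr (max_rearr x n) p * ennreal (w n) < \<infinity>"
    by (meson le_less_trans)
  then have "max_rearr x n \<noteq> \<infinity>"
    using assms by (auto simp: ennpowr_def ennreal_top_mult)
  then have "decr_rearr x 1 \<noteq> \<infinity>" unfolding max_rearr_eq_top_iff[OF \<open>1 \<le> n\<close>] .
  then show ?thesis
    using decr_rearr_antimono[OF \<open>1 \<le> i\<close>, of x] by (simp add: less_top le_less_trans)
qed

text \<open>
  If \<open>\<bar>x\<bar>\<close> exceeded \<open>e\<close> infinitely often, \<open>e\<close> would be a lower bound of the rearrangement and of its
  averages, and the modular would be at least \<open>e powr p\<close> times the total weight.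
\<close>

lemma finite_level_set:
  assumes "gamma_modular p w x < \<infinity>" "W_inf w = \<infinity>" "0 < p" "0 < e"
  shows "finite {k \<in> {1..}. e < \<bar>x k\<bar>}" (is "finite ?A")
proof (rule ccontr)
  assume inf: "infinite ?A"
  have *: "ennreal e \<le> decr_rearr x n" if "1 \<le> n" for n
  proof -
    obtain B where "finite B" "card B = n" "B \<subseteq> ?A"
      using infinite_arbitrarily_large[OF inf] by blast
    then show ?thesis using that by (intro decr_rearr_ge_card[of B]) auto
  qed
  have "ennreal e \<le> max_rearr x n" if "1 \<le> n" for n
  proof -
    have "of_nat n * ennreal e \<le> (\<Sum>i=1..n. decr_rearr x i)"
      using sum_bounded_below[of "{1..n}" "ennreal e" "decr_rearr x"] * by simp
    then have "of_nat n * ennreal e / of_nat n \<le> max_rearr x n"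
      unfolding max_rearr_def by (rule divide_right_mono_ennreal)
    then show ?thesis
      using that by (simp add: mult.commute ennreal_mult_divide_eq)
  qed
  then have "ennpowr (ennreal e) p * ennreal (w (Suc j)) \<le> ennpowr (max_rearr x (Suc j)) p * ennreal (w (Suc j))" for j
    using assms by (intro mult_right_mono ennpowr_mono) auto
  then have "(\<Sum>j. ennpowr (ennreal e) p * ennreal (w (Suc j))) \<le> gamma_modular p w x"
    unfolding gamma_modular_def by (intro suminf_le) auto
  moreover have "(\<Sum>j. ennpowr (ennreal e) p * ennreal (w (Suc j))) = \<infinity>"
    using assms by (simp add: W_inf_def ennpowr_ennreal ennreal_mult_top)
  ultimately show False using assms by (simp add: top_unique)
qed

section \<open>Strict convexity\<close>

lemma max_rearr_midpoint_le:
  assumes "\<And>k. 1 \<le> k \<Longrightarrow> x k = (y k + z k) / 2" "\<And>i. 1 \<le> i \<Longrightarrow> decr_rearr x i < \<infinity>"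
  shows "2 * max_rearr x n \<le> max_rearr y n + max_rearr z n"
  using divide_right_mono_ennreal[OF sum_decr_rearr_midpoint_le[OF assms], of n "of_nat n"]
  unfolding max_rearr_def by (simp add: ennreal_times_divide add_divide_distrib_ennreal)

text \<open>
  The chain $x^{**}(n)^p \le ((y^{**}(n) + z^{**}(n))/2)^p \le (y^{**}(n)^p + z^{**}(n)^p)/2$ becomes
  an equality after summation against the weight, hence is one for each \<open>n\<close>; strict convexity then
  gives $y^{**}(n) = z^{**}(n)$.
\<close>

lemma max_rearr_eq_of_midpoint:
  assumes p: "1 < p" and w: "\<And>n. 1 \<le> n \<Longrightarrow> 0 < w n"
    and x: "\<And>k. 1 \<le> k \<Longrightarrow> x k = (y k + z k) / 2"
    and 1: "gamma_modular p w x = 1" "gamma_modular p w y = 1" "gamma_modular p w z = 1"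
    and n: "1 \<le> n"
  shows "max_rearr y n = max_rearr x n"
proof -
  define R where "R v j = enn2real (max_rearr v (Suc j))" for v j
  have R: "max_rearr v (Suc j) = ennreal (R v j)" if "gamma_modular p w v = 1" for v j
  proof -
    have "decr_rearr v 1 < \<infinity>"
      using decr_rearr_finite[of p w v 1 1] that w by simp
    then have "max_rearr v (Suc j) \<noteq> \<infinity>"
      using max_rearr_eq_top_iff[of "Suc j" v] by auto
    then show ?thesis by (simp add: R_def less_top)
  qed
  have nn: "0 \<le> R v j" for v j by (simp add: R_def)
  have w': "0 \<le> w (Suc j)" for j using w[of "Suc j"] by simp
  define f where "f v j = R v j powr p * w (Suc j)" for v j
  have f: "f v sums 1" if "gamma_modular p w v = 1" for v
  proof -
    have f_nn: "0 \<le> f v j" for j by (simp add: f_def w')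
    have "(\<Sum>j. ennreal (f v j)) = 1"
      using that unfolding gamma_modular_def f_def R[OF that]
      by (simp add: ennpowr_ennreal nn ennreal_mult w')
    moreover from this have summable: "summable (f v)"
      by (intro summable_suminf_not_top f_nn) simp
    ultimately have "ennreal (suminf (f v)) = 1"
      by (simp only: suminf_ennreal2[OF f_nn summable])
    with summable show ?thesis by (simp add: sums_iff)
  qed
  have mid: "R x j \<le> (R y j + R z j) / 2" for j
  proof -
    have fin: "decr_rearr x i < \<infinity>" if "1 \<le> i" for i
      using decr_rearr_finite[of p w x 1 i] 1 w that by simp
    have "2 * max_rearr x (Suc j) \<le> max_rearr y (Suc j) + max_rearr z (Suc j)"
      by (rule max_rearr_midpoint_le) (fact x fin)+
    then have "2 * ennreal (R x j) \<le> ennreal (R y j) + ennreal (R z j)"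
      by (simp only: R[OF 1(1)] R[OF 1(2)] R[OF 1(3)])
    then show ?thesis by (simp add: nn numeral_mult_ennreal flip: ennreal_plus)
  qed
  \<comment> \<open>Contrapositive of strict convexity: a non-strict outer inequality forces \<open>R y j = R z j\<close>.\<close>
  have conv: "(R y j + R z j) / 2 = R y j" if "\<not> R x j powr p < (R y j powr p + R z j powr p) / 2" for j
  proof (rule ccontr)
    assume "(R y j + R z j) / 2 \<noteq> R y j"
    then have "((R y j + R z j) / 2) powr p < (R y j powr p + R z j powr p) / 2"
      using p nn by (intro powr_midpoint_less) auto
    moreover have "R x j powr p \<le> ((R y j + R z j) / 2) powr p"
      using mid nn p by (intro powr_mono2) auto
    ultimately show False using that by simp
  qed
  have le: "R x j powr p \<le> (R y j powr p + R z j powr p) / 2" for j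
  proof (cases "R y j = R z j")
    case True
    then show ?thesis using powr_mono2[of p "R x j" "R y j"] mid[of j] nn[of x j] p by simp
  next
    case False
    then show ?thesis using conv[of j] by force
  qed
  define g where "g = (\<lambda>j. (f y j + f z j) / 2 - f x j)"
  have g: "g j = ((R y j powr p + R z j powr p) / 2 - R x j powr p) * w (Suc j)" for j
    by (simp add: g_def f_def algebra_simps add_divide_distrib)
  have "g sums ((1 + 1) / 2 - 1)"
    unfolding g_def by (intro sums_diff sums_divide sums_add f 1)
  then have "summable g" "suminf g = 0" by (auto simp: sums_iff)
  moreover have "0 \<le> g j" for j using le w' by (simp add: g)
  ultimately have g0: "g j = 0" for j by (simp add: suminf_eq_zero_iff)
  have eq: "R x j powr p = (R y j powr p + R z j powr p) / 2" for j
    using w[of "Suc j"] g0[of j] unfolding g by simp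
  then have "R z j = R y j" for j using conv[of j] by simp
  then have "R x j powr p = R y j powr p" for j using eq by simp
  then have "R x j = R y j" for j
    using powr_less_mono2[of p "R x j" "R y j"] powr_less_mono2[of p "R y j" "R x j"] p nn
    by (cases "R x j" "R y j" rule: linorder_cases) auto
  then show ?thesis using R[of x "n - 1"] R[of y "n - 1"] 1 n by simp
qed

lemma strictly_convex_gamma:
  assumes p: "1 < p" and w: "\<And>n. 1 \<le> n \<Longrightarrow> 0 < w n" and W: "W_inf w = \<infinity>"
  shows "strictly_convex (gamma_space p w) (gamma_norm p w)"
proof -
  have eq: "x = y \<and> y = z"
    if 0: "x 0 = 0" "y 0 = 0" "z 0 = 0"
      and 1: "gamma_modular p w x = 1" "gamma_modular p w y = 1" "gamma_modular p w z = 1"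
      and mid: "x = (\<lambda>k. (y k + z k) / 2)" for x y z
  proof -
    have x: "x k = (y k + z k) / 2" "x k = (z k + y k) / 2" if "1 \<le> k" for k
      by (simp_all add: mid add.commute)
    have max_y: "max_rearr y n = max_rearr x n" if "1 \<le> n" for n
      by (rule max_rearr_eq_of_midpoint[where z = z, OF p]) (fact w x 1 that)+
    have max_z: "max_rearr z n = max_rearr x n" if "1 \<le> n" for n
      by (rule max_rearr_eq_of_midpoint[where z = y, OF p]) (fact w x 1 that)+
    have sum: "(\<Sum>i=1..n. decr_rearr v i) = of_nat n * max_rearr v n" for v n
      by (cases "n = 0") (simp_all add: max_rearr_def ennreal_times_divide mult.commute[of "of_nat n"]
          ennreal_mult_divide_eq)
    have S: "(\<Sum>i=1..n. decr_rearr y i) = (\<Sum>i=1..n. decr_rearr x i)"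
      "(\<Sum>i=1..n. decr_rearr z i) = (\<Sum>i=1..n. decr_rearr x i)" for n
      unfolding sum using max_y[of n] max_z[of n] by (cases "n = 0"; simp)+
    have fin: "finite {k \<in> {1..}. e < \<bar>x k\<bar>}" if "0 < e" for e
      using finite_level_set[of p w x e] p W that 1 by simp
    have "y k = x k" if "1 \<le> k" for k
      by (rule eq_of_midpoint(1)[where z = z]) (fact x S fin that)+
    moreover have "z k = x k" if "1 \<le> k" for k
      by (rule eq_of_midpoint(2)[where y = y]) (fact x S fin that)+
    ultimately have "y k = x k" "z k = x k" for k
      using 0 by (cases "k = 0"; simp)+
    then show ?thesis by auto
  qed
  have "0 < p" using p by simp
  show ?thesis
    unfolding strictly_convex_def extreme_point_unit_ball_def in_unit_sphere_gamma_iff[OF \<open>0 < p\<close>]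
  proof (intro ballI conjI impI)
    fix x y z
    assume "x \<in> unit_sphere (gamma_space p w) (gamma_norm p w)"
      "y \<in> unit_sphere (gamma_space p w) (gamma_norm p w)"
      "z \<in> unit_sphere (gamma_space p w) (gamma_norm p w)" "x = (\<lambda>k. (y k + z k) / 2)"
    then have "x = y \<and> y = z"
      using eq[of x y z] unfolding in_unit_sphere_gamma_iff[OF \<open>0 < p\<close>] by simp
    then show "x = y" "y = z" by auto
  qed (simp_all add: in_unit_sphere_gamma_iff[OF \<open>0 < p\<close>])
qed

section \<open>Failure of strict convexity\<close>

lemma gamma_modular_split:
  "gamma_modular p w x = ennpowr (max_rearr x 1) p * ennreal (w 1) +
     (\<Sum>j. ennpowr (max_rearr x (Suc (Suc j))) p * ennreal (w (Suc (Suc j))))"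
  unfolding gamma_modular_def
  using suminf_offset[of "\<lambda>j. ennpowr (max_rearr x (Suc j)) p * ennreal (w (Suc j))" 1]
  by (simp add: add.commute)

text \<open>
  The averages of a sequence with finitely many nonzero entries decay like \<open>S / n\<close>; this is what the
  summability condition on a weight controls.
\<close>

lemma suminf_tail_eq_W_tail:
  assumes w: "\<And>n. 1 \<le> n \<Longrightarrow> 0 \<le> w n" and "0 \<le> S"
  shows "(\<Sum>j. ennpowr (ennreal (S / real (Suc (Suc j)))) p * ennreal (w (Suc (Suc j)))) =
           ennreal (S powr p) * W_tail p w 1"
proof -
  have "ennpowr (ennreal (S / real (Suc (Suc j)))) p * ennreal (w (Suc (Suc j))) =
      ennreal (S powr p) * ennreal (w (1 + 1 + j) / real (1 + 1 + j) powr p)" for j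
    using assms by (simp add: ennpowr_ennreal powr_divide flip: ennreal_mult)
  then show ?thesis by (simp add: W_tail_def)
qed

lemma gamma_modular_finite:
  assumes w: "nonneg_weight p w" and p: "0 < p" and S: "0 \<le> S"
    and le: "\<And>n. 1 \<le> n \<Longrightarrow> (\<Sum>i=1..n. decr_rearr x i) \<le> ennreal S"
  shows "gamma_modular p w x < \<infinity>"
proof -
  have max: "max_rearr x n \<le> ennreal (S / real n)" if "1 \<le> n" for n
  proof -
    have "max_rearr x n \<le> ennreal S / of_nat n"
      unfolding max_rearr_def using le[OF that] by (rule divide_right_mono_ennreal)
    also have "\<dots> = ennreal (S / real n)"
      using that S by (simp add: divide_ennreal ennreal_of_nat_eq_real_of_nat)
    finally show ?thesis .
  qed
  have "gamma_modular p w x \<le> ennpowr (ennreal S) p * ennreal (w 1) +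
     (\<Sum>j. ennpowr (ennreal (S / real (Suc (Suc j)))) p * ennreal (w (Suc (Suc j))))"
    unfolding gamma_modular_split
  proof (intro add_mono mult_right_mono suminf_le ennpowr_mono p max)
    show "max_rearr x 1 \<le> ennreal S" using max[of 1] by simp
  qed auto
  also have "\<dots> = ennpowr (ennreal S) p * ennreal (w 1) + ennreal (S powr p) * W_tail p w 1"
    using w S by (subst suminf_tail_eq_W_tail) (auto simp: nonneg_weight_def)
  also have "\<dots> < \<infinity>"
    using w S by (auto simp: ennpowr_ennreal nonneg_weight_def ennreal_mult_less_top)
  finally show ?thesis .
qed

lemma gamma_modular_pos:
  assumes "nonneg_weight p w" "0 < p" "0 < decr_rearr x 1"
  shows "0 < gamma_modular p w x"
proof -
  obtain n where n: "1 \<le> n" "0 < w n" using assms by (auto simp: nonneg_weight_def)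
  have "decr_rearr x 1 \<le> (\<Sum>i=1..n. decr_rearr x i)"
    using n by (intro member_le_sum) auto
  then have "0 < (\<Sum>i=1..n. decr_rearr x i)" using assms(3) by (meson less_le_trans)
  then have "0 < max_rearr x n"
    using n by (simp add: max_rearr_def ennreal_zero_less_divide of_nat_less_top)
  then have "0 < ennpowr (max_rearr x n) p"
    by (cases "max_rearr x n") (auto simp: ennpowr_def)
  with n have "0 < ennpowr (max_rearr x n) p * ennreal (w n)"
    by (simp add: ennreal_zero_less_mult_iff)
  also have "\<dots> \<le> gamma_modular p w x"
    unfolding gamma_modular_def
    using suminf_ennreal_term_le[of "\<lambda>j. ennpowr (max_rearr x (Suc j)) p * ennreal (w (Suc j))" "n - 1"]
      n by simp
  finally show ?thesis .
qed

lemma gamma_modular_swap: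
  assumes "1 \<le> i" "1 \<le> j"
  shows "gamma_modular p w (x \<circ> Transposition.transpose i j) = gamma_modular p w x"
  by (simp add: gamma_modular_def max_rearr_def decr_rearr_swap[OF assms])

subsection \<open>A summable weight\<close>

lemma gamma_modular_eq_W_inf:
  assumes p: "0 < p" and le: "\<And>k. 1 \<le> k \<Longrightarrow> \<bar>x k\<bar> \<le> 1" and eq: "\<And>k. 2 \<le> k \<Longrightarrow> \<bar>x k\<bar> = 1"
  shows "gamma_modular p w x = W_inf w"
proof -
  have "decr_rearr x n = 1" if "1 \<le> n" for n
  proof (rule antisym)
    have empty: "{k \<in> {1..}. 1 < \<bar>x k\<bar>} = {}" using le by force
    have "decr_rearr x n \<le> ennreal 1"
      by (rule decr_rearr_le) (simp_all only: empty, simp_all)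
    then show "decr_rearr x n \<le> 1" by simp
    have "ennreal 1 \<le> decr_rearr x n"
      using that eq by (intro decr_rearr_ge_card[of "{2..Suc n}"]) auto
    then show "1 \<le> decr_rearr x n" by simp
  qed
  then have "max_rearr x (Suc j) = 1" for j
    by (simp add: max_rearr_def divide_eq_1_ennreal)
  moreover have "ennpowr 1 p = 1" by (simp add: ennpowr_def)
  ultimately show ?thesis by (simp add: gamma_modular_def W_inf_def)
qed

lemma not_strictly_convex_if_W_inf_finite:
  assumes p: "0 < p" and w: "nonneg_weight p w" and W: "W_inf w < \<infinity>"
  shows "\<not> strictly_convex (gamma_space p w) (gamma_norm p w)"
proof -
  define u :: "real \<Rightarrow> nat \<Rightarrow> real" where "u a k = (if k = 0 then 0 else if k = 1 then a else 1)" for a k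
  have u: "gamma_modular p w (u a) = W_inf w" if "\<bar>a\<bar> \<le> 1" for a
    using that by (intro gamma_modular_eq_W_inf p) (auto simp: u_def)
  obtain n where n: "1 \<le> n" "0 < w n" using w by (auto simp: nonneg_weight_def)
  have "ennreal (w n) \<le> W_inf w"
    unfolding W_inf_def using suminf_ennreal_term_le[of "\<lambda>j. ennreal (w (Suc j))" "n - 1"] n by simp
  then have pos: "0 < W_inf w" using n by (meson ennreal_less_zero_iff less_le_trans)
  show ?thesis
  proof (rule not_strictly_convexI[OF p pos W, of w "u 0" "u 1" "u (-1)"])
    have "u 1 1 \<noteq> u (- 1) 1" by (simp add: u_def)
    then show "u 1 \<noteq> u (- 1)" by metis
  qed (auto simp: u, auto simp: u_def)
qed

subsection \<open>A vanishing weight\<close>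

lemma not_strictly_convex_if_weight_zero:
  assumes p: "0 < p" and w: "nonneg_weight p w" and m: "1 \<le> m" "w m = 0"
  shows "\<not> strictly_convex (gamma_space p w) (gamma_norm p w)"
proof -
  define x :: "nat \<Rightarrow> real" where
    "x k = (if k = 0 then 0 else if k < m then 2 else if k \<le> Suc m then 1 else 0)" for k
  define y :: "nat \<Rightarrow> real" where "y k = (if k = 0 then 0 else if k \<le> m then 2 else 0)" for k
  define z where "z = y \<circ> Transposition.transpose m (Suc m)"
  have rx: "decr_rearr x n = ennreal (x n)" if "1 \<le> n" for n
    using that by (intro decr_rearr_decreasing) (auto simp: x_def)
  have ry: "decr_rearr y n = ennreal (y n)" if "1 \<le> n" for n
    using that by (intro decr_rearr_decreasing) (auto simp: y_def)
  have sx: "(\<Sum>i=1..n. decr_rearr x i) = ennreal (\<Sum>i=1..n. x i)" for n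
    by (simp add: rx) (simp add: x_def)
  have sy: "(\<Sum>i=1..n. decr_rearr y i) = ennreal (\<Sum>i=1..n. y i)" for n
    by (simp add: ry) (simp add: y_def)
  have diff: "(\<Sum>i=1..n. y i) - (\<Sum>i=1..n. x i) = (if n = m then 1 else 0)" for n
    by (induction n) (use m in \<open>auto simp: x_def y_def\<close>)
  have max: "max_rearr x n = max_rearr y n" if "n \<noteq> m" for n
    unfolding max_rearr_def sx sy using diff[of n] that by simp
  have "ennpowr (max_rearr x (Suc j)) p * ennreal (w (Suc j)) =
      ennpowr (max_rearr y (Suc j)) p * ennreal (w (Suc j))" for j
    using max[of "Suc j"] m by (cases "Suc j = m") auto
  then have x: "gamma_modular p w x = gamma_modular p w y"
    by (simp add: gamma_modular_def)
  have z: "gamma_modular p w z = gamma_modular p w y"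
    using m by (simp add: z_def gamma_modular_swap)
  have "gamma_modular p w y < \<infinity>"
  proof (rule gamma_modular_finite[OF w p])
    fix n :: nat assume "1 \<le> n"
    have "(\<Sum>i=1..n. y i) \<le> (\<Sum>i\<in>{1..n} \<inter> {1..m}. 2)"
      by (subst sum.inter_restrict) (auto intro!: sum_mono simp: y_def)
    also have "\<dots> \<le> 2 * real m"
      using card_mono[of "{1..m}" "{1..n} \<inter> {1..m}"] by simp
    finally show "(\<Sum>i=1..n. decr_rearr y i) \<le> ennreal (2 * real m)"
      unfolding sy by (rule ennreal_leI)
  qed simp
  moreover have "0 < gamma_modular p w y"
    using m by (intro gamma_modular_pos[OF w p]) (simp add: ry, simp add: y_def)
  ultimately show ?thesis
  proof (intro not_strictly_convexI[of p "gamma_modular p w y" w x y z])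
    fix k show "x k = (y k + z k) / 2"
      using m by (auto simp: x_def y_def z_def Transposition.transpose_def)
    have "y m \<noteq> z m" using m by (simp add: y_def z_def)
    then show "y \<noteq> z" by metis
    show "z 0 = 0" using m by (simp add: y_def z_def Transposition.transpose_def)
  qed (use p x z in \<open>simp_all add: x_def y_def\<close>)
qed

subsection \<open>An exponent at most one\<close>

definition pair_seq :: "real \<Rightarrow> real \<Rightarrow> nat \<Rightarrow> real" where
  "pair_seq a b k = (if k = 1 then a else if k = 2 then b else 0)"

lemma gamma_modular_pair_seq:
  assumes w: "\<And>n. 1 \<le> n \<Longrightarrow> 0 \<le> w n" and C: "W_tail p w 1 = ennreal C" "0 \<le> C" and ab: "0 \<le> a" "0 \<le> b"
  shows "gamma_modular p w (pair_seq a b) = ennreal (max a b powr p * w 1 + (a + b) powr p * C)"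
proof -
  have *: "gamma_modular p w (pair_seq a b) = ennreal (a powr p * w 1 + (a + b) powr p * C)"
    if ab: "0 \<le> b" "b \<le> a" for a b
  proof -
    have r: "decr_rearr (pair_seq a b) n = ennreal (pair_seq a b n)" if "1 \<le> n" for n
      using that ab by (intro decr_rearr_decreasing) (auto simp: pair_seq_def)
    have sum: "(\<Sum>i=1..n. pair_seq a b i) = (if n = 0 then 0 else if n = 1 then a else a + b)" for n
      by (induction n) (auto simp: pair_seq_def)
    have "(\<Sum>i=1..n. decr_rearr (pair_seq a b) i) = ennreal (\<Sum>i=1..n. pair_seq a b i)" for n
      using ab by (simp add: r) (simp add: pair_seq_def)
    then have m: "max_rearr (pair_seq a b) n = ennreal ((\<Sum>i=1..n. pair_seq a b i) / real n)" if "1 \<le> n" for n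
      using that ab unfolding max_rearr_def sum
      by (simp add: divide_ennreal ennreal_of_nat_eq_real_of_nat)
    have "gamma_modular p w (pair_seq a b) = ennpowr (ennreal a) p * ennreal (w 1) +
       (\<Sum>j. ennpowr (ennreal ((a + b) / real (Suc (Suc j)))) p * ennreal (w (Suc (Suc j))))"
      unfolding gamma_modular_split using m[of 1] m[of "Suc (Suc _)"] unfolding sum by simp
    also have "\<dots> = ennpowr (ennreal a) p * ennreal (w 1) + ennreal ((a + b) powr p) * W_tail p w 1"
      using w ab by (subst suminf_tail_eq_W_tail) auto
    also have "\<dots> = ennreal (a powr p * w 1 + (a + b) powr p * C)"
      using w[of 1] ab C by (simp add: ennpowr_ennreal flip: ennreal_mult ennreal_plus)
    finally show ?thesis .
  qed
  show ?thesis
  proof (cases "b \<le> a")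
    case True
    then show ?thesis using * ab by (simp add: max_def)
  next
    case False
    have "pair_seq a b = pair_seq b a \<circ> Transposition.transpose 1 2"
      by (auto simp: pair_seq_def Transposition.transpose_def)
    then have "gamma_modular p w (pair_seq a b) = gamma_modular p w (pair_seq b a)"
      by (simp add: gamma_modular_swap)
    then show ?thesis using * ab False by (simp add: max_def add.commute)
  qed
qed

text \<open>
  The point \<open>pair_seq (s t * (1 - t)) (s t)\<close> is the projection of \<open>(1 - t, 1)\<close> to the sphere through
  \<open>(1, 0)\<close>, whose modular is \<open>K\<close>, and \<open>h t\<close> is the modular of its midpoint with \<open>(1, 0)\<close>. The second
  coordinate keeps the two points apart for all \<open>t\<close>.
\<close>

lemma not_strictly_convex_if_exponent_le_1:
  assumes p: "0 < p" "p \<le> 1" and w: "nonneg_weight p w" and w1: "0 < w 1"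
  shows "\<not> strictly_convex (gamma_space p w) (gamma_norm p w)"
proof -
  have wn: "0 \<le> w n" if "1 \<le> n" for n using w that by (simp add: nonneg_weight_def)
  obtain C where C: "W_tail p w 1 = ennreal C" "0 \<le> C"
    using w by (cases "W_tail p w 1") (auto simp: nonneg_weight_def)
  define F where "F a b = max a b powr p * w 1 + (a + b) powr p * C" for a b
  have F: "gamma_modular p w (pair_seq a b) = ennreal (F a b)" if "0 \<le> a" "0 \<le> b" for a b
    unfolding F_def using gamma_modular_pair_seq[of w p C a b] wn C that by simp
  define K where "K = w 1 + C"
  have K: "0 < K" using w1 C by (simp add: K_def)
  define D where "D t = w 1 + (2 - t) powr p * C" for t
  have D: "0 < D t" for t using w1 C by (simp add: D_def add_pos_nonneg)
  define s where "s t = (K / D t) powr (1 / p)" for t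
  have s: "0 < s t" for t using K D[of t] by (simp add: s_def)
  have s_powr: "s t powr p = K / D t" for t
    using K D[of t] p by (simp add: s_def powr_powr)
  have Fz: "F (s t * (1 - t)) (s t) = K" if t: "0 \<le> t" "t \<le> 1" for t
  proof -
    have "max (s t * (1 - t)) (s t) = s t" using s[of t] t by (auto simp: max_def mult_le_cancel_left2)
    moreover have "s t * (1 - t) + s t = s t * (2 - t)" by (simp add: algebra_simps)
    ultimately have "F (s t * (1 - t)) (s t) = s t powr p * D t"
      using s[of t] t by (simp only: F_def D_def powr_mult) (simp add: distrib_left powr_mult)
    then show ?thesis using s_powr[of t] D[of t] by simp
  qed
  define h where "h t = F ((1 + s t * (1 - t)) / 2) (s t / 2)" for t
  have cont: "continuous_on {0..1} h"
  proof -
    have "continuous_on {0..1} D"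
      unfolding D_def using p by (intro continuous_intros continuous_on_powr') auto
    then have cs: "continuous_on {0..1} s"
      unfolding s_def using D K
      by (intro continuous_on_powr' continuous_intros) (auto simp: less_imp_neq[symmetric] less_imp_le)
    have a: "0 < (1 + s t * (1 - t)) / 2" if "t \<in> {0..1}" for t
      using s[of t] that by (simp add: add_pos_nonneg)
    have pos: "0 < max ((1 + s t * (1 - t)) / 2) (s t / 2)" "0 < (1 + s t * (1 - t)) / 2 + s t / 2"
      if "t \<in> {0..1}" for t
      using a[OF that] s[of t] by linarith+
    have ca: "continuous_on {0..1} (\<lambda>t. (1 + s t * (1 - t)) / 2)"
      and cb: "continuous_on {0..1} (\<lambda>t. s t / 2)"
      by (intro continuous_intros cs; simp)+
    have cp: "continuous_on {0..1} (\<lambda>t. g t powr p)"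
      if "continuous_on {0..1} g" "\<And>t. t \<in> {0..1} \<Longrightarrow> 0 < g t" for g :: "real \<Rightarrow> real"
      using that p by (intro continuous_on_powr' continuous_on_const) (auto simp: less_imp_le)
    show ?thesis
      unfolding h_def F_def
      by (intro continuous_on_add continuous_on_mult_right cp continuous_on_max ca cb pos)
  qed
  have "h 1 \<le> K"
  proof -
    have "s 1 = 1" using K by (simp add: s_def D_def K_def)
    then have "h 1 = (1 / 2) powr p * w 1 + C" by (simp add: h_def F_def)
    also have "\<dots> \<le> K" using w1 p by (simp add: K_def powr_le1)
    finally show ?thesis .
  qed
  moreover have "K \<le> h 0"
  proof -
    have "K = (K + F (s 0) (s 0)) / 2" using Fz[of 0] by simp
    also have "\<dots> = (1 powr p + s 0 powr p) / 2 * w 1 + (1 powr p + (2 * s 0) powr p) / 2 * C"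
      by (simp add: F_def K_def algebra_simps add_divide_distrib)
    also have "\<dots> \<le> ((1 + s 0) / 2) powr p * w 1 + ((1 + 2 * s 0) / 2) powr p * C"
      using s[of 0] w1 C p by (intro add_mono mult_right_mono powr_midpoint_ge) auto
    also have "\<dots> = h 0" 
      using s[of 0] by (simp add: h_def F_def max_def add_divide_distrib add.commute)
    finally show ?thesis .
  qed
  ultimately obtain t where t: "0 \<le> t" "t \<le> 1" "h t = K"
    using IVT2'[of h 1 K 0, OF _ _ _ cont] by auto
  show ?thesis
  proof (rule not_strictly_convexI[of p "ennreal K" w "pair_seq ((1 + s t * (1 - t)) / 2) (s t / 2)"
        "pair_seq 1 0" "pair_seq (s t * (1 - t)) (s t)"])
    show "gamma_modular p w (pair_seq ((1 + s t * (1 - t)) / 2) (s t / 2)) = ennreal K"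
      using s[of t] t by (simp add: F flip: h_def)
    show "gamma_modular p w (pair_seq 1 0) = ennreal K"
      by (simp add: F) (simp add: F_def K_def)
    show "gamma_modular p w (pair_seq (s t * (1 - t)) (s t)) = ennreal K"
      using s[of t] t by (simp add: F Fz)
    have "pair_seq 1 0 2 \<noteq> pair_seq (s t * (1 - t)) (s t) 2"
      using s[of t] by (simp add: pair_seq_def)
    then show "pair_seq 1 0 \<noteq> pair_seq (s t * (1 - t)) (s t)" by metis
  qed (use p K in \<open>auto simp: pair_seq_def\<close>)
qed

subsection \<open>The necessary conditions\<close>

lemma strictly_convex_gamma_imp:
  assumes p: "0 < p" and w: "nonneg_weight p w"
    and sc: "strictly_convex (gamma_space p w) (gamma_norm p w)"
  shows "1 < p \<and> (\<forall>n\<ge>1. 0 < w n) \<and> W_inf w = \<infinity>"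
proof -
  have pos: "0 < w n" if "1 \<le> n" for n
  proof -
    have "w n \<noteq> 0" using not_strictly_convex_if_weight_zero[OF p w that] sc by blast
    moreover have "0 \<le> w n" using w that by (simp add: nonneg_weight_def)
    ultimately show ?thesis by simp
  qed
  moreover have "1 < p"
    using not_strictly_convex_if_exponent_le_1[OF p _ w] pos[of 1] sc by force
  moreover have "W_inf w = \<infinity>"
    using not_strictly_convex_if_W_inf_finite[OF p w] sc by (auto simp flip: less_top)
  ultimately show ?thesis by blast
qed

section \<open>The characterisation\<close>

theorem theorem4p6:
  fixes p :: real and w :: "nat \<Rightarrow> real"
  assumes "0 < p" and "nonneg_weight p w"
  shows "strictly_convex (gamma_space p w) (gamma_norm p w) \<longleftrightarrow>
           1 < p \<and> (\<forall>n\<ge>1. 0 < w n) \<and> W_inf w = \<infinity>"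
proof
  assume "strictly_convex (gamma_space p w) (gamma_norm p w)"
  with assms show "1 < p \<and> (\<forall>n\<ge>1. 0 < w n) \<and> W_inf w = \<infinity>"
    by (rule strictly_convex_gamma_imp)
next
  assume "1 < p \<and> (\<forall>n\<ge>1. 0 < w n) \<and> W_inf w = \<infinity>"
  then show "strictly_convex (gamma_space p w) (gamma_norm p w)"
    by (intro strictly_convex_gamma) auto
qed

end
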